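(* For every integer $n\ge 0$, the following identity of polynomials in $x$ holds: \begin{multline*} \sum_{k=0}^{n}B_{k}(x)B_{n-k}(x)=\sum_{k=0}^{n}\left(2^{k+2}k+2^{k+1}\right)\Biggl[\frac{2}{n+2}\sum_{l=0}^{n-2}\sum_{\substack{0\le j\le l\\ j-k\equiv 0 \pmod 2}}B_{n-l}B_{l-j}\frac{\binom{n+2}{l}\binom{l}{j}\,j!\left(\frac{j+k+2}{2}\right)!}{\left(\frac{j-k}{2}\right)!\,(j+k+2)!}\\ +(n+1)\sum_{\substack{0\le l\le n\\ l-k\equiv 0 \pmod 2}}\binom{n}{l}B_{n-l}\frac{l!\left(\frac{l+k+2}{2}\right)!}{\left(\frac{l-k}{2}\right)!\,(l+k+2)!}\Biggr]P_{k}(x), \end{multline*} where the sum over $l$ from $0$ to $n-2$ is empty when $n<2$.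
   Context: $P_k(x)$ denotes the $k$-th Legendre polynomial, defined by $\frac{1}{\sqrt{1-2xt+t^2}}=\sum_{k\ge 0}P_k(x)t^k$ (equivalently $P_k(x)=\frac{1}{k!2^k}\frac{d^k}{dx^k}(x^2-1)^k$). The Bernoulli polynomials $B_n(x)$ are defined by $\frac{t}{e^t-1}e^{xt}=\sum_{n\ge0}B_n(x)\frac{t^n}{n!}$, and $B_m:=B_m(0)$ denotes the $m$-th Bernoulli number. Convention: terms with $j<k$ (resp. $l<k$) are taken to be $0$, i.e. $1/m!=0$ for negative integers $m$. *)

theory Defs
  imports
    "HOL-Computational_Algebra.Computational_Algebra"
    "HOL-Number_Theory.Cong"
begin

(* Formal power series in t with coefficients in \<real>[x] model the two generating functions, so the
   Bernoulli and Legendre polynomials are obtained as elements of \<real>[x].  \<real>[x] is not a field and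
   the library's fps_exp, fps_binomial and quotients need one, so series with constant
   coefficients are built over \<real> and then embedded coefficientwise. *)

definition fps_embed :: "real fps \<Rightarrow> real poly fps" where
  "fps_embed f = Abs_fps (\<lambda>n. [:fps_nth f n:])"

definition bernoulli_gf :: "real poly fps" where
  "bernoulli_gf =
     fps_embed (fps_X / (fps_exp 1 - 1)) * Abs_fps (\<lambda>n. monom (1 / fact n) n)"

definition bernoulli_poly :: "nat \<Rightarrow> real poly" where
  "bernoulli_poly n = smult (fact n) (fps_nth bernoulli_gf n)"

definition bernoulli_num :: "nat \<Rightarrow> real" where
  "bernoulli_num n = poly (bernoulli_poly n) 0"

(* fps_binomial (-1/2) is the series of (1 + u) powr (-1/2); here u = t^2 - 2 x t. *)

definition legendre_gf :: "real poly fps" where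
  "legendre_gf =
     fps_compose (fps_embed (fps_binomial (- 1 / 2))) (fps_X ^ 2 - fps_const [:0, 2:] * fps_X)"

definition legendre_poly :: "nat \<Rightarrow> real poly" where
  "legendre_poly k = fps_nth legendre_gf k"

definition inv_fact :: "int \<Rightarrow> real" where
  "inv_fact m = (if m < 0 then 0 else 1 / fact (nat m))"


(* The lemmas below confirm that the series are the intended ones:
   bernoulli_gf * (e^t - 1) = t e^(x t), and legendre_gf is the square root of
   1 / (1 - 2 x t + t^2) with constant term 1. *)

lemma fps_embed_mult: "fps_embed (f * g) = fps_embed f * fps_embed g"
proof (rule fps_ext)
  fix n
  have "(\<Sum>i=0..n. [:h i:]) = [:\<Sum>i=0..n. h i:]" for h :: "nat \<Rightarrow> real"
    by (induction n) (auto simp: sum.atLeast0_atMost_Suc)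
  then show "fps_nth (fps_embed (f * g)) n = fps_nth (fps_embed f * fps_embed g) n"
    by (simp add: fps_embed_def fps_mult_nth mult.commute)
qed

lemma bernoulli_gf_eq:
  "bernoulli_gf * fps_embed (fps_exp 1 - 1) = fps_X * Abs_fps (\<lambda>n. monom (1 / fact n) n)"
proof -
  have "fps_nth (fps_exp 1 - 1 :: real fps) 1 \<noteq> 0"
    by simp
  then have nz: "fps_exp 1 - 1 \<noteq> (0 :: real fps)"
    by (metis fps_zero_nth)
  have "subdegree (fps_exp 1 - 1 :: real fps) = 1"
    by (rule subdegreeI) auto
  then have "fps_X / (fps_exp 1 - 1) * (fps_exp 1 - 1) = (fps_X :: real fps)"
    using nz by (intro dvd_div_mult_self) (simp add: fps_dvd_iff)
  then have "fps_embed (fps_X / (fps_exp 1 - 1)) * fps_embed (fps_exp 1 - 1) = fps_embed fps_X"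
    by (metis fps_embed_mult)
  moreover have "fps_embed fps_X = fps_X"
    by (rule fps_ext) (simp add: fps_embed_def fps_X_def)
  ultimately show ?thesis
    unfolding bernoulli_gf_def by (metis (no_types, lifting) mult.assoc mult.commute)
qed

lemma legendre_gf_square:
  "legendre_gf ^ 2 * (1 - fps_const [:0, 2:] * fps_X + fps_X ^ 2) = 1"
proof -
  define u :: "real poly fps" where "u = fps_X ^ 2 - fps_const [:0, 2:] * fps_X"
  have u0: "fps_nth u 0 = 0"
    by (simp add: u_def)
  define h where "h = fps_binomial (- 1 / 2 :: real)"
  have "h * h * (1 + fps_X) = 1"
    unfolding h_def fps_binomial_add_mult [symmetric]
    by (simp add: fps_binomial_minus_one inverse_mult_eq_1)
  moreover have "fps_embed (1 + fps_X) = 1 + fps_X" "fps_embed 1 = 1"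
    by (auto intro!: fps_ext simp: fps_embed_def fps_X_def one_pCons)
  ultimately have "fps_embed h * fps_embed h * (1 + fps_X) = 1"
    by (metis fps_embed_mult)
  then have "fps_compose (fps_embed h * fps_embed h * (1 + fps_X)) u = 1"
    by simp
  then have "legendre_gf * legendre_gf * (1 + u) = 1"
    using u0
    by (simp add: fps_compose_mult_distrib fps_compose_add_distrib legendre_gf_def h_def u_def)
  then show ?thesis
    by (simp add: u_def power2_eq_square algebra_simps)
qed

lemma legendre_gf_nth_0: "fps_nth legendre_gf 0 = 1"
  by (simp add: legendre_gf_def fps_embed_def one_pCons)

end

(* Both sides of the convolution identity
     sum_k B_k(x) B_(n-k)(x) = 2/(n+2) sum_(l<=n-2) C(n+2,l) B_(n-l) B_l(x) + (n+1) B_n(x)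
   satisfy D_n' = (n+1) D_(n-1) and have the same increment D_n(1) - D_n(0) for n >= 1; this forces
   them to agree.  The Legendre expansion of x^j, obtained by induction on j from Bonnet's recurrence,
   then turns B_l(x) = sum_j C(l,j) B_(l-j) x^j into a combination of Legendre polynomials. *)

theory Submission
  imports Defs
begin

section \<open>Bernoulli polynomials: explicit form, derivative, endpoint values\<close>

lemma smult_sum_right: "smult c (\<Sum>i\<in>A. f i) = (\<Sum>i\<in>A. smult c (f i))"
  by (induction A rule: infinite_finite_induct) (auto simp: smult_add_right)

lemma pderiv_sum: "pderiv (\<Sum>i\<in>A. f i) = (\<Sum>i\<in>A. pderiv (f i))"
  using higher_pderiv_sum[of 1 f A] by simp

lemma bernoulli_gf_nth:
  "fps_nth bernoulli_gf n =
     (\<Sum>i=0..n. monom (fps_nth (fps_X / (fps_exp 1 - 1)) (n - i) / fact i) i)"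
  unfolding bernoulli_gf_def
  by (subst mult.commute) (simp add: fps_mult_nth fps_embed_def smult_monom)

lemma bernoulli_num_eq:
  "bernoulli_num n = fact n * fps_nth (fps_X / (fps_exp 1 - 1)) n"
  by (simp add: bernoulli_num_def bernoulli_poly_def bernoulli_gf_nth poly_sum poly_monom
      sum.atLeast_Suc_atMost power_0_left)

lemma bernoulli_poly_expansion:
  "bernoulli_poly n = (\<Sum>i\<le>n. monom (real (n choose i) * bernoulli_num (n - i)) i)"
  unfolding bernoulli_poly_def bernoulli_gf_nth smult_sum_right atLeast0AtMost
  by (intro sum.cong) (auto simp: smult_monom bernoulli_num_eq binomial_fact field_simps)

lemma bernoulli_poly_0 [simp]: "bernoulli_poly 0 = 1"
proof -
  \<comment> \<open>\<open>e^t - 1\<close> has constant term 0 and t-coefficient 1, so the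
    t-coefficient of the product isolates the constant coefficient of
    \<open>bernoulli_gf\<close>.\<close>
  have "fps_nth (bernoulli_gf * fps_embed (fps_exp 1 - 1)) 1 = fps_nth bernoulli_gf 0"
    by (simp add: fps_mult_nth fps_embed_def)
  then show ?thesis
    by (simp add: bernoulli_gf_eq bernoulli_poly_def)
qed

lemma pderiv_bernoulli_poly:
  "pderiv (bernoulli_poly (Suc n)) = smult (real (Suc n)) (bernoulli_poly n)"
proof -
  have "pderiv (bernoulli_poly (Suc n)) =
      (\<Sum>i\<le>Suc n. monom (real i * (real (Suc n choose i) * bernoulli_num (Suc n - i))) (i - 1))"
    by (simp only: bernoulli_poly_expansion pderiv_sum pderiv_monom of_nat_mult)
  also have "\<dots> =
      (\<Sum>i\<le>n. monom (real (Suc i) * (real (Suc n choose Suc i) * bernoulli_num (n - i))) i)"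
    by (subst sum.atMost_Suc_shift) simp
  also have "\<dots> = (\<Sum>i\<le>n. monom (real (Suc n) * (real (n choose i) * bernoulli_num (n - i))) i)"
  proof (intro sum.cong refl)
    fix i
    have "real (Suc i) * real (Suc n choose Suc i) = real (Suc n) * real (n choose i)"
      by (metis Suc_times_binomial of_nat_mult)
    then show "monom (real (Suc i) * (real (Suc n choose Suc i) * bernoulli_num (n - i))) i =
        monom (real (Suc n) * (real (n choose i) * bernoulli_num (n - i))) i"
      by (metis mult.assoc)
  qed
  finally show ?thesis
    by (simp only: bernoulli_poly_expansion smult_sum_right smult_monom)
qed

text \<open>At x = 0, \<open>bernoulli_gf_eq\<close> becomes F(t) (e^t - 1) = t. Up to n!, the t^n
  coefficient of F(t) e^t is B_n(1) and that of F(t) is B_n(0), so only n = 1 produces a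
  jump.\<close>

lemma poly_bernoulli_poly_1:
  "poly (bernoulli_poly n) 1 = bernoulli_num n + (if n = 1 then 1 else 0)"
proof -
  \<comment> \<open>The conditional term is the contribution of the constant -1 in
    \<open>e^t - 1\<close>, kept inside the sum so that it matches the Cauchy product term by
    term.\<close>
  have "(\<Sum>i=0..n. poly (fps_nth bernoulli_gf i) 0 * (1 / fact (n - i)) -
        (if i = n then poly (fps_nth bernoulli_gf i) 0 else 0))
      = poly (fps_nth (bernoulli_gf * fps_embed (fps_exp 1 - 1)) n) 0"
    by (auto simp: fps_mult_nth fps_embed_def poly_sum fps_one_def intro!: sum.cong)
  also have "\<dots> = (if n = 1 then 1 else 0)"
    unfolding bernoulli_gf_eq by (auto simp: poly_monom power_0_left)
  finally have *: "(\<Sum>i=0..n. poly (fps_nth bernoulli_gf i) 0 / fact (n - i)) -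
      poly (fps_nth bernoulli_gf n) 0 = (if n = 1 then 1 else 0)"
    by (simp add: sum_subtractf)
  have "poly (bernoulli_poly n) 1 = (\<Sum>i\<le>n. real (n choose i) * bernoulli_num (n - i))"
    by (simp add: bernoulli_poly_expansion poly_sum poly_monom)
  also have "\<dots> = (\<Sum>i\<le>n. real (n choose i) * bernoulli_num i)"
    by (rule sum.reindex_bij_witness[of _ "\<lambda>i. n - i" "\<lambda>i. n - i"])
       (auto simp: binomial_symmetric[symmetric])
  also have "\<dots> = fact n * (\<Sum>i=0..n. poly (fps_nth bernoulli_gf i) 0 / fact (n - i))"
    unfolding sum_distrib_left atLeast0AtMost
    by (intro sum.cong)
       (auto simp: bernoulli_num_def bernoulli_poly_def binomial_fact field_simps)
  also have "\<dots> = fact n * (poly (fps_nth bernoulli_gf n) 0 + (if n = 1 then 1 else 0))"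
    using * by (simp add: algebra_simps)
  \<comment> \<open>The factor n! on the extra term is harmless: that term is nonzero only for n =
    1.\<close>
  also have "\<dots> = bernoulli_num n + (if n = 1 then 1 else 0)"
    by (simp add: bernoulli_num_def bernoulli_poly_def algebra_simps)
  finally show ?thesis .
qed

text \<open>Expanding B_2(1) = B_2(0) by the binomial formula leaves 2 B_1 + 1 = 0.\<close>

lemma bernoulli_num_1: "bernoulli_num 1 = - 1 / 2"
proof -
  have "poly (bernoulli_poly 2) 1 = bernoulli_num 2 + 2 * bernoulli_num 1 + 1"
    unfolding bernoulli_poly_expansion[of 2]
    by (simp add: poly_sum poly_monom numeral_2_eq_2 bernoulli_num_def[of 0])
  then show ?thesis
    using poly_bernoulli_poly_1[of 2] by simp
qed

section \<open>The convolution identity for Bernoulli polynomials\<close>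

text \<open>If D_n is a constant c, then D_(n+1) is (n+2) c x + d, and equal values at 0 and 1 force
  c = 0. Then D_(n+1) has derivative 0 as well, and the argument repeats.\<close>

lemma appell_periodic_eq_0:
  fixes D :: "nat \<Rightarrow> real poly"
  assumes "pderiv (D 0) = 0"
    and D': "\<And>n. pderiv (D (Suc n)) = smult (real n + 2) (D n)"
    and per: "\<And>n. poly (D (Suc n)) 1 = poly (D (Suc n)) 0"
  shows "D n = 0"
proof -
  have step: "D n = 0" if const: "pderiv (D n) = 0" for n
  proof -
    obtain c where c: "D n = [:c:]"
      using pderiv_iszero[OF const] by blast
    have "pderiv (D (Suc n) - [:0, (real n + 2) * c:]) = 0"
      by (simp add: pderiv_diff D' c pderiv_pCons)
    then obtain d where "D (Suc n) - [:0, (real n + 2) * c:] = [:d:]"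
      using pderiv_iszero by blast
    then have "D (Suc n) = [:d:] + [:0, (real n + 2) * c:]"
      by (simp add: algebra_simps)
    then show ?thesis
      using per[of n] c by simp
  qed
  show ?thesis
    by (induction n) (use step assms in auto)
qed

lemma bernoulli_poly_convolution:
  "(\<Sum>k=0..n. bernoulli_poly k * bernoulli_poly (n - k)) =
     smult (2 / (real n + 2))
       (\<Sum>l | l + 2 \<le> n. smult (real ((n + 2) choose l) * bernoulli_num (n - l)) (bernoulli_poly l))
     + smult (real n + 1) (bernoulli_poly n)"
proof -
  define Q where "Q n = (\<Sum>k=0..n. bernoulli_poly k * bernoulli_poly (n - k))" for n
  define S where "S n =
    (\<Sum>l | l + 2 \<le> n. smult (real ((n + 2) choose l) * bernoulli_num (n - l)) (bernoulli_poly l))" for n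
  define R where "R n = smult (2 / (real n + 2)) (S n) + smult (real n + 1) (bernoulli_poly n)" for n
  \<comment> \<open>Truncated subtraction makes the right side empty for n < 2, as required.\<close>
  have set: "{l. l + 2 \<le> n} = {..<n - 1}" for n :: nat
    by auto
  have Q': "pderiv (Q (Suc n)) = smult (real n + 2) (Q n)" for n
  proof -
    have "pderiv (Q (Suc n)) =
        (\<Sum>k=0..Suc n. bernoulli_poly k * pderiv (bernoulli_poly (Suc n - k))) +
        (\<Sum>k=0..Suc n. bernoulli_poly (Suc n - k) * pderiv (bernoulli_poly k))"
      by (simp only: Q_def pderiv_sum pderiv_mult sum.distrib)
    \<comment> \<open>In each of the two sums the term differentiating B_0 drops out. The remaining
      weights n - k + 1 and k + 1 add up to n + 2.\<close>
    also have "(\<Sum>k=0..Suc n. bernoulli_poly k * pderiv (bernoulli_poly (Suc n - k))) =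
        (\<Sum>k=0..n. smult (real (n - k) + 1) (bernoulli_poly k * bernoulli_poly (n - k)))"
      by (auto simp: Suc_diff_le pderiv_bernoulli_poly add_ac intro!: sum.cong)
    also have "(\<Sum>k=0..Suc n. bernoulli_poly (Suc n - k) * pderiv (bernoulli_poly k)) =
        (\<Sum>k=0..n. smult (real k + 1) (bernoulli_poly k * bernoulli_poly (n - k)))"
      by (subst sum.atLeast0_atMost_Suc_shift)
         (auto simp: pderiv_bernoulli_poly mult_ac add_ac intro!: sum.cong)
    finally show ?thesis
      by (auto simp: Q_def smult_sum_right sum.distrib[symmetric] smult_add_left[symmetric] of_nat_diff
          intro!: sum.cong)
  qed
  have S': "pderiv (S (Suc n)) = smult (real n + 3) (S n)" for n
  proof (cases n)
    case 0
    then show ?thesis by (simp add: S_def set lessThan_Suc)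
  next
    case (Suc m)
    \<comment> \<open>The l = 0 term is constant and vanishes; the other terms are shifted down by
      one. The absorption rule (l+1) C(n+3, l+1) = (n+3) C(n+2, l) then extracts the factor n +
      3.\<close>
    have "pderiv (S (Suc n)) = (\<Sum>l<m. smult (real ((n + 3) choose Suc l) * bernoulli_num (n - l) *
        real (Suc l)) (bernoulli_poly l))"
      unfolding S_def set using Suc
      by (simp add: pderiv_add pderiv_pCons pderiv_sum pderiv_smult sum.lessThan_Suc_shift pderiv_bernoulli_poly numeral_3_eq_3
          del: sum.lessThan_Suc binomial_Suc_Suc of_nat_Suc)
    also have "\<dots> = (\<Sum>l<m. smult ((real n + 3) * (real ((n + 2) choose l) * bernoulli_num (n - l)))
        (bernoulli_poly l))"
    proof (intro sum.cong refl)
      fix l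
      have "real (Suc l) * real (Suc (n + 2) choose Suc l) = real (Suc (n + 2)) * real ((n + 2) choose l)"
        by (metis Suc_times_binomial of_nat_mult)
      then have "real (Suc l) * real ((n + 3) choose Suc l) = (real n + 3) * real ((n + 2) choose l)"
        by (simp add: numeral_3_eq_3 del: binomial_Suc_Suc)
      then have "real ((n + 3) choose Suc l) * bernoulli_num (n - l) * real (Suc l) =
          (real n + 3) * (real ((n + 2) choose l) * bernoulli_num (n - l))"
        by (metis mult.assoc mult.commute)
      then show "smult (real ((n + 3) choose Suc l) * bernoulli_num (n - l) * real (Suc l)) (bernoulli_poly l)
          = smult ((real n + 3) * (real ((n + 2) choose l) * bernoulli_num (n - l))) (bernoulli_poly l)"
        by (simp only:)
    qed
    finally show ?thesis
      unfolding S_def set using Suc by (simp add: smult_sum_right)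
  qed
  have R': "pderiv (R (Suc n)) = smult (real n + 2) (R n)" for n
  proof -
    \<comment> \<open>The prefactor of \<open>S (Suc n)\<close> in \<open>R (Suc n)\<close> cancels
      the n + 3 from \<open>S'\<close>; the remaining 2 is rewritten to show the factor n + 2
      demanded for \<open>R\<close>.\<close>
    have "2 / (real n + 3) * (real n + 3) = (real n + 2) * (2 / (real n + 2))"
      by (simp add: field_simps)
    then have "pderiv (smult (2 / (real n + 3)) (S (Suc n))) = smult (real n + 2) (smult (2 / (real n + 2)) (S n))"
      by (simp only: pderiv_smult S' smult_smult)
    moreover have "real (Suc n) + 2 = real n + 3"
      by simp
    ultimately show ?thesis
      by (simp only: R_def pderiv_add smult_add_right) (simp add: pderiv_smult pderiv_bernoulli_poly add_ac)
  qed
  have Q1: "poly (Q (Suc n)) 1 - poly (Q (Suc n)) 0 =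
      (if n = 0 then 2 else if n = 1 then 0 else 2 * bernoulli_num n)" for n
  proof -
    \<comment> \<open>With B_k(1) = B_k + [k = 1], the product of the factors at k and n + 1 - k
      gains a term when either index is 1, plus a 1 when both are. For n = 1 these cancel because
      B_1 = -1/2.\<close>
    have "poly (Q (Suc n)) 1 - poly (Q (Suc n)) 0 =
       (\<Sum>k=0..Suc n. (if k = 1 then bernoulli_num (Suc n - k) else 0) +
          (if k = n then bernoulli_num k else 0) + (if k = 1 \<and> n = 1 then 1 else 0))"
      unfolding Q_def poly_sum sum_subtractf[symmetric]
      by (rule sum.cong) (auto simp: poly_bernoulli_poly_1 bernoulli_num_def[symmetric] algebra_simps)
    also have "\<dots> = (if n = 0 then 2 else if n = 1 then 0 else 2 * bernoulli_num n)"
      using bernoulli_num_1 bernoulli_num_def[of 0] by (auto simp: sum.distrib sum.delta)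
    finally show ?thesis .
  qed
  have R1: "poly (R (Suc n)) 1 - poly (R (Suc n)) 0 =
      (if n = 0 then 2 else if n = 1 then 0 else 2 * bernoulli_num n)" for n
  proof -
    \<comment> \<open>Only l = 1 jumps, with coefficient C(n+3, 1) B_n, and this index is in range
      only for n at least 2. The value 2 at n = 0 comes from the separate term of
      \<open>R\<close>.\<close>
    have "poly (S (Suc n)) 1 - poly (S (Suc n)) 0 =
       (\<Sum>k<n. if k = 1 then (real n + 3) * bernoulli_num n else 0)"
      unfolding S_def poly_sum sum_subtractf[symmetric] set
      by (rule sum.cong) (auto simp: poly_bernoulli_poly_1 bernoulli_num_def[symmetric] algebra_simps)
    also have "\<dots> = (if n \<le> 1 then 0 else (real n + 3) * bernoulli_num n)"
      by auto
    finally have "poly (S (Suc n)) 1 =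
        poly (S (Suc n)) 0 + (if n \<le> 1 then 0 else (real n + 3) * bernoulli_num n)"
      by simp
    moreover have "2 * (s + (real n + 3) * b) / (3 + real n) = 2 * s / (3 + real n) + 2 * b" for s b
      by (simp add: field_simps)
    ultimately show ?thesis
      by (auto simp: R_def poly_bernoulli_poly_1 bernoulli_num_def[symmetric])
  qed
  have "Q n - R n = 0"
  proof (rule appell_periodic_eq_0[where D = "\<lambda>n. Q n - R n"])
    show "pderiv (Q 0 - R 0) = 0"
      by (simp add: Q_def R_def S_def one_pCons)
    show "pderiv (Q (Suc n) - R (Suc n)) = smult (real n + 2) (Q n - R n)" for n
      by (simp add: pderiv_diff Q' R' smult_diff_right)
    show "poly (Q (Suc n) - R (Suc n)) 1 = poly (Q (Suc n) - R (Suc n)) 0" for n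
      using Q1[of n] R1[of n] by simp
  qed
  then show ?thesis
    by (simp add: Q_def R_def S_def)
qed

section \<open>Legendre polynomials: Bonnet's recurrence and the expansion of powers\<close>

text \<open>Differentiating G^2 w = 1 in t, where w = 1 - 2xt + t^2 has derivative -2(x - t), gives
  2G (w G' - (x - t) G) = 0; the nonzero factor 2G cancels.\<close>

lemma legendre_gf_deriv:
  "(1 - fps_const [:0, 2:] * fps_X + fps_X ^ 2) * fps_deriv legendre_gf =
     (fps_const [:0, 1:] - fps_X) * legendre_gf"
proof -
  define G where "G = legendre_gf"
  define w :: "real poly fps" where "w = 1 - fps_const [:0, 2:] * fps_X + fps_X ^ 2"
  have "fps_deriv (G ^ 2 * w) = fps_deriv 1"
    unfolding G_def w_def legendre_gf_square ..
  moreover have "fps_const [:0, 2:] = (2 :: real poly fps) * fps_const [:0, 1:]"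
    by (simp add: fps_numeral_fps_const numeral_poly)
  ultimately have "2 * G * (w * fps_deriv G - (fps_const [:0, 1:] - fps_X) * G) = 0"
    by (simp add: w_def power2_eq_square algebra_simps)
  moreover have "G \<noteq> 0"
    using legendre_gf_nth_0 by (auto simp: G_def)
  ultimately show ?thesis
    by (simp add: G_def w_def)
qed

lemma legendre_poly_0: "legendre_poly 0 = 1"
  by (simp add: legendre_poly_def legendre_gf_nth_0)

text \<open>Bonnet's recurrence, read off as the t^k coefficient of
  \<open>legendre_gf_deriv\<close>. For k = 0 the truncated index k - 1 is 0, but its factor
  vanishes.\<close>

lemma legendre_poly_recurrence:
  "smult (2 * real k + 1) ([:0, 1:] * legendre_poly k) =
     smult (real k + 1) (legendre_poly (Suc k)) + smult (real k) (legendre_poly (k - 1))"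
proof -
  define X :: "real poly" where "X = [:0, 1:]"
  have X2: "fps_const [:0, 2:] = 2 * fps_const X"
    by (simp add: X_def fps_numeral_fps_const numeral_poly)
  have "fps_nth ((1 - 2 * fps_const X * fps_X + fps_X ^ 2) * fps_deriv legendre_gf) k =
     fps_nth ((fps_const X - fps_X) * legendre_gf) k"
    using legendre_gf_deriv by (simp only: X2 flip: X_def)
  then have "(2 * of_nat k + 1) * (X * legendre_poly k) =
     (of_nat k + 1) * legendre_poly (Suc k) + of_nat k * legendre_poly (k - 1)"
  proof (cases k)
    case 0
    then show ?thesis
      using \<open>fps_nth _ k = _\<close>
      by (simp add: legendre_poly_def ring_distribs mult.assoc fps_mult_nth_0)
  next
    case (Suc m)
    then show ?thesis
      using \<open>fps_nth _ k = _\<close>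
      by (cases m) (simp_all add: legendre_poly_def power2_eq_square mult.assoc
          fps_numeral_fps_const algebra_simps)
  qed
  moreover have smult_real: "smult (real m) p = of_nat m * p" for m p
    by (simp add: of_nat_poly)
  moreover have "smult (2 * real k + 1) p = (2 * of_nat k + 1) * p"
    "smult (real k + 1) p = (of_nat k + 1) * p" for p
    using smult_real[of "2 * k + 1" p] smult_real[of "k + 1" p] by (simp_all add: add_ac)
  ultimately show ?thesis
    by (simp only: flip: X_def)
qed

(* legendre_coeff j k is the coefficient of (2k+1) P_k(x) in x^j; inv_fact makes it vanish for k > j. *)
definition legendre_coeff :: "nat \<Rightarrow> nat \<Rightarrow> real" where
  "legendre_coeff j k =
     (if [j = k] (mod 2) then
        2 ^ (k + 1) * (fact j * fact ((j + k + 2) div 2) *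
          inv_fact ((int j - int k) div 2) / fact (j + k + 2))
      else 0)"

text \<open>Writing j = k + 2i removes the parity test, the integer divisions and
  \<open>inv_fact\<close>; all other pairs are handled by
  \<open>legendre_coeff_eq_0\<close>.\<close>

lemma legendre_coeff_add:
  "legendre_coeff (k + 2 * i) k =
     2 ^ (k + 1) * fact (k + 2 * i) * fact (k + i + 1) / (fact i * fact (2 * k + 2 * i + 2))"
proof -
  have "(k + 2 * i + k + 2) div 2 = k + i + 1" "k + 2 * i + k + 2 = 2 * k + 2 * i + 2"
    by auto
  moreover have "(int (k + 2 * i) - int k) div 2 = int i"
    by simp
  ultimately show ?thesis
    by (simp add: legendre_coeff_def inv_fact_def cong_def)
qed

lemma legendre_coeff_eq_0:
  assumes "\<not> (\<exists>i. j = k + 2 * i)"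
  shows "legendre_coeff j k = 0"
proof (cases "[j = k] (mod 2)")
  case True
  have "j < k"
  proof (rule ccontr)
    assume "\<not> j < k"
    then have "even (j - k)"
      using True by (simp add: cong_def mod_eq_dvd_iff_nat)
    then show False
      using assms \<open>\<not> j < k\<close> by (metis dvdE le_add_diff_inverse linorder_not_less)
  qed
  then show ?thesis
    by (simp add: legendre_coeff_def inv_fact_def)
qed (simp add: legendre_coeff_def)

text \<open>Expanding x * x^j by Bonnet's recurrence, P_k receives k times the coefficient at k - 1
  and k + 1 times the one at k + 1. All terms vanish unless j + 1 = k + 2i; otherwise the claim is a
  relation between factorial quotients.\<close>

lemma legendre_coeff_recurrence:
  "(2 * real k + 1) * legendre_coeff (Suc j) k =
     (if k = 0 then 0 else real k * legendre_coeff j (k - 1)) + (real k + 1) * legendre_coeff j (Suc k)"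
proof (cases "\<exists>i. Suc j = k + 2 * i")
  case False
  have "\<not> (\<exists>i. j = Suc k + 2 * i)"
  proof
    assume "\<exists>i. j = Suc k + 2 * i"
    then obtain i where "j = Suc k + 2 * i" ..
    then have "Suc j = k + 2 * Suc i" by simp
    then show False using False by blast
  qed
  moreover have "\<not> (\<exists>i. j = k - 1 + 2 * i)" if "k > 0"
    using False that by auto
  ultimately show ?thesis
    using False by (simp add: legendre_coeff_eq_0)
next
  case True
  then obtain i where i: "Suc j = k + 2 * i" by blast
  have fact_Suc_real: "fact (Suc m) = (real m + 1) * (fact m :: real)" for m
    by simp
  show ?thesis
  proof (cases k)
    case 0
    then obtain m where m: "i = Suc m"
      using i by (cases i) auto
    then have j: "j = Suc 0 + 2 * m" "Suc j = 0 + 2 * Suc m"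
      using i 0 by auto
    have 1: "legendre_coeff (Suc j) k = 2 * fact (2 * m + 2) * fact (m + 2) / (fact (Suc m) * fact (2 * m + 4))"
      unfolding 0 j(2) legendre_coeff_add by (simp add: eval_nat_numeral)
    have 2: "legendre_coeff j (Suc k) = 4 * fact (2 * m + 1) * fact (m + 2) / (fact m * fact (2 * m + 4))"
      unfolding 0 j(1) legendre_coeff_add by (simp add: eval_nat_numeral)
    have 3: "fact (2 * m + 2) = (2 * real m + 2) * (fact (2 * m + 1) :: real)"
      using fact_Suc_real[of "2 * m + 1"] by simp
    \<comment> \<open>With the factorials as atoms, only the cancellation of 2(2m + 2) / (m + 1) to
      4 remains.\<close>
    define A B C F where "A = (fact (2 * m + 1) :: real)" and "B = (fact (m + 2) :: real)"
      and "C = (fact m :: real)" and "F = (fact (2 * m + 4) :: real)"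
    note defs = this
    have "2 * ((2 * real m + 2) * A) * B / ((real m + 1) * C * F) = 4 * A * B / (C * F)"
      by (simp add: defs(3,4) divide_simps del: fact_Suc)
    then show ?thesis
      unfolding 1 2 3 fact_Suc_real defs(1-4) by (simp only: 0) (simp del: fact_Suc)
  next
    case (Suc p)
    have j: "j = p + 2 * i" "Suc j = Suc p + 2 * i"
      using i Suc by auto
    have 1: "legendre_coeff (Suc j) k =
        2 ^ (p + 2) * fact (p + 2 * i + 1) * fact (p + i + 2) / (fact i * fact (2 * p + 2 * i + 4))"
      unfolding Suc j(2) legendre_coeff_add by (simp add: eval_nat_numeral)
    have 2: "legendre_coeff j p =
        2 ^ (p + 1) * fact (p + 2 * i) * fact (p + i + 1) / (fact i * fact (2 * p + 2 * i + 2))"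
      unfolding j(1) legendre_coeff_add by simp
    \<comment> \<open>Writing 1/(i-1)! as i/i! keeps the formula valid for i = 0, where j < p + 2
      and the coefficient is 0.\<close>
    have 3: "legendre_coeff j (Suc (Suc p)) =
        2 ^ (p + 3) * fact (p + 2 * i) * fact (p + i + 2) * real i / (fact i * fact (2 * p + 2 * i + 4))"
    proof (cases i)
      case 0
      then show ?thesis using j
        by (auto intro!: legendre_coeff_eq_0)
    next
      case (Suc m)
      have j': "j = Suc (Suc p) + 2 * m" using Suc j by simp
      show ?thesis
        unfolding j' legendre_coeff_add
        by (simp add: Suc eval_nat_numeral field_simps del: fact_Suc) (simp add: field_simps)
    qed
    define F where "F = (fact (2 * p + 2 * i + 2) :: real)"
    define G where "G = (fact (p + i + 1) :: real)"
    define H where "H = (fact (p + 2 * i) :: real)"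
    have F: "fact (2 * p + 2 * i + 4) = (2 * real p + 2 * real i + 4) * ((2 * real p + 2 * real i + 3) * F)"
      using fact_Suc_real[of "2 * p + 2 * i + 3"] fact_Suc_real[of "2 * p + 2 * i + 2"]
      by (simp add: F_def eval_nat_numeral add_ac del: fact_Suc)
    have G: "fact (p + i + 2) = (real p + real i + 2) * G"
      using fact_Suc_real[of "p + i + 1"] by (simp add: G_def eval_nat_numeral del: fact_Suc)
    have H: "fact (p + 2 * i + 1) = (real p + 2 * real i + 1) * H"
      using fact_Suc_real[of "p + 2 * i"] by (simp add: H_def del: fact_Suc)
    \<comment> \<open>All three coefficients are rational multiples of u over c, and the claim
      reduces to (2p+3)(p+2i+1) = (p+1)(2p+2i+3) + 2i(p+2).\<close>
    define u where "u = legendre_coeff j p"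
    define c where "c = 2 * real p + 2 * real i + 3"
    have "c > 0"
      by (simp add: c_def add_nonneg_pos)
    have D: "2 * real p + 2 * real i + 4 = 2 * (real p + real i + 2)" "real p + real i + 2 > 0"
      by auto
    have u: "u = 2 ^ (p + 1) * H * G / (fact i * F)"
      by (simp only: u_def 2 F_def G_def H_def)
    have 1: "legendre_coeff (Suc j) k = u * (real p + 2 * real i + 1) / c"
      unfolding 1 u F G H c_def[symmetric] D(1) using D(2) by (simp add: divide_simps)
    have 3: "legendre_coeff j (Suc (Suc p)) = u * (2 * real i) / c"
      unfolding 3 u F G H_def[symmetric] c_def[symmetric] D(1) using D(2)
      by (simp add: divide_simps eval_nat_numeral)
    have "(2 * real p + 3) * (u * (real p + 2 * real i + 1)) =
        (real p + 1) * u * c + (real p + 2) * (u * (2 * real i))"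
      by (simp add: c_def algebra_simps)
    then have "(2 * real p + 3) * (u * (real p + 2 * real i + 1) / c) =
        (real p + 1) * u + (real p + 2) * (u * (2 * real i) / c)"
      using \<open>c > 0\<close> by (simp add: field_simps)
    then show ?thesis
      unfolding 1 by (simp add: Suc 3 u_def add_ac)
  qed
qed

text \<open>The upper limit is any n \<ge> j, since the coefficients beyond j vanish; this lets
  expansions of different powers share one index range.\<close>

lemma monom_legendre_expansion:
  assumes "j \<le> n"
  shows "monom 1 j = (\<Sum>k=0..n. smult ((2 * real k + 1) * legendre_coeff j k) (legendre_poly k))"
  using assms
proof (induction j arbitrary: n)
  case 0
  have "legendre_coeff 0 k = (if k = 0 then 1 else 0)" for k
    using legendre_coeff_add[of 0 0] legendre_coeff_eq_0[of 0 k] by (cases k) (auto simp: numeral_2_eq_2)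
  then show ?case
    by (simp add: legendre_poly_0 if_distrib[of "\<lambda>x. _ * x"] if_distrib[of "\<lambda>x. smult x _"] sum.delta
      monom_0 one_pCons cong: if_cong)
next
  case (Suc j)
  \<comment> \<open>The induction hypothesis is used with limit n - 1, so that raising the index by
    one ends exactly at n.\<close>
  then obtain m where m: "n = Suc m" "j \<le> m"
    by (cases n) auto
  have out: "legendre_coeff j k = 0" if "k > m" for k
    using that m by (intro legendre_coeff_eq_0) auto
  have "monom 1 (Suc j) = [:0, 1:] * (monom 1 j :: real poly)"
    by (simp add: monom_Suc)
  also have "\<dots> = (\<Sum>k=0..m. smult (legendre_coeff j k)
      (smult (2 * real k + 1) ([:0, 1:] * legendre_poly k)))"
    by (simp add: Suc.IH[OF m(2)] sum_distrib_left mult.commute)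
  also have "\<dots> = (\<Sum>k=0..m. smult (real (Suc k) * legendre_coeff j k) (legendre_poly (Suc k))) +
      (\<Sum>k=0..m. smult (real k * legendre_coeff j k) (legendre_poly (k - 1)))"
    unfolding legendre_poly_recurrence
    by (simp add: smult_add_right sum.distrib mult.commute add.commute)
  also have "(\<Sum>k=0..m. smult (real (Suc k) * legendre_coeff j k) (legendre_poly (Suc k))) =
      (\<Sum>k=0..n. smult (if k = 0 then 0 else real k * legendre_coeff j (k - 1)) (legendre_poly k))"
    unfolding m by (subst sum.atLeast0_atMost_Suc_shift) simp
  \<comment> \<open>Padding with zero terms up to n + 1 makes the downward shift also end at n; the
    k = 0 term vanishes through its factor k.\<close>
  also have "(\<Sum>k=0..m. smult (real k * legendre_coeff j k) (legendre_poly (k - 1))) =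
      (\<Sum>k=0..Suc n. smult (real k * legendre_coeff j k) (legendre_poly (k - 1)))"
    using m by (simp add: out)
  also have "\<dots> = (\<Sum>k=0..n. smult ((real k + 1) * legendre_coeff j (Suc k)) (legendre_poly k))"
    by (subst sum.atLeast0_atMost_Suc_shift) (simp add: add_ac)
  finally show ?case
    by (simp add: legendre_coeff_recurrence smult_add_left sum.distrib)
qed

section \<open>Legendre expansion of Bernoulli polynomials and the final identity\<close>

lemma bernoulli_poly_legendre_expansion:
  assumes "l \<le> n"
  shows "bernoulli_poly l = (\<Sum>k=0..n. smult ((2 * real k + 1) *
    (\<Sum>j\<le>l. real (l choose j) * bernoulli_num (l - j) * legendre_coeff j k)) (legendre_poly k))"
proof -
  have "bernoulli_poly l = (\<Sum>j\<le>l. smult (real (l choose j) * bernoulli_num (l - j)) (monom 1 j))"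
    by (simp add: bernoulli_poly_expansion smult_monom)
  also have "\<dots> = (\<Sum>j\<le>l. \<Sum>k=0..n. smult (real (l choose j) * bernoulli_num (l - j) *
      ((2 * real k + 1) * legendre_coeff j k)) (legendre_poly k))"
    using assms by (intro sum.cong) (simp_all add: monom_legendre_expansion[of _ n] smult_sum_right)
  also have "\<dots> = (\<Sum>k=0..n. \<Sum>j\<le>l. smult (real (l choose j) * bernoulli_num (l - j) *
      ((2 * real k + 1) * legendre_coeff j k)) (legendre_poly k))"
    by (rule sum.swap)
  finally show ?thesis
    by (simp only: smult_sum[symmetric] sum_distrib_left mult_ac)
qed

text \<open>Translates between the parity-restricted sums of the theorem and full sums in which
  \<open>legendre_coeff\<close> carries both the parity condition and the power of 2.\<close>

lemma sum_legendre_coeff: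
  "2 ^ (k + 1) * (\<Sum>j | j \<le> l \<and> [j = k] (mod 2). c j * (fact j * fact ((j + k + 2) div 2) *
     inv_fact ((int j - int k) div 2) / fact (j + k + 2))) = (\<Sum>j\<le>l. c j * legendre_coeff j k)"
proof -
  have "{j. j \<le> l \<and> [j = k] (mod 2)} = {j \<in> {..l}. [j = k] (mod 2)}"
    by auto
  then show ?thesis
    unfolding sum_distrib_left
    by (simp only: sum.inter_filter finite_atMost) (auto simp: legendre_coeff_def intro!: sum.cong)
qed

theorem theorem4:
  fixes n :: nat
  shows "(\<Sum>k = 0..n. bernoulli_poly k * bernoulli_poly (n - k)) =
    (\<Sum>k = 0..n.
       smult
         ((2 ^ (k + 2) * real k + 2 ^ (k + 1)) *
          (2 / (real n + 2) *
             (\<Sum>l | l + 2 \<le> n. \<Sum>j | j \<le> l \<and> [j = k] (mod 2).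
                bernoulli_num (n - l) * bernoulli_num (l - j) *
                (real ((n + 2) choose l) * real (l choose j) * fact j * fact ((j + k + 2) div 2) *
                   inv_fact ((int j - int k) div 2) / fact (j + k + 2)))
           + (real n + 1) *
             (\<Sum>l | l \<le> n \<and> [l = k] (mod 2).
                real (n choose l) * bernoulli_num (n - l) *
                (fact l * fact ((l + k + 2) div 2) *
                   inv_fact ((int l - int k) div 2) / fact (l + k + 2)))))
         (legendre_poly k))"
proof -
  define E where "E l k = (\<Sum>j\<le>l. real (l choose j) * bernoulli_num (l - j) * legendre_coeff j k)" for l k
  define w where "w l = real ((n + 2) choose l) * bernoulli_num (n - l)" for l
  have B: "bernoulli_poly l = (\<Sum>k=0..n. smult ((2 * real k + 1) * E l k) (legendre_poly k))"
    if "l \<le> n" for l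
    unfolding E_def by (rule bernoulli_poly_legendre_expansion[OF that])
  \<comment> \<open>The weight in the theorem is 2k + 1 from the expansion of x^j times the 2^(k+1)
    contained in \<open>legendre_coeff\<close>.\<close>
  have const: "(2 * real k + 1) * (2 ^ (k + 1) * c) = (2 ^ (k + 2) * real k + 2 ^ (k + 1)) * c" for k c
    by (simp add: algebra_simps)
  have "(\<Sum>l | l + 2 \<le> n. smult (w l) (bernoulli_poly l)) =
      (\<Sum>l | l + 2 \<le> n. \<Sum>k=0..n. smult (w l * ((2 * real k + 1) * E l k)) (legendre_poly k))"
    by (intro sum.cong) (auto simp: B smult_sum_right)
  also have "\<dots> = (\<Sum>k=0..n. smult (\<Sum>l | l + 2 \<le> n. w l * ((2 * real k + 1) * E l k)) (legendre_poly k))"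
    unfolding smult_sum by (rule sum.swap)
  \<comment> \<open>All the B_l, including B_n, are expanded over the same range 0..n, so the
    coefficients of each P_k can be collected.\<close>
  finally have "(\<Sum>k=0..n. bernoulli_poly k * bernoulli_poly (n - k)) =
      (\<Sum>k=0..n. smult ((2 * real k + 1) *
        (2 / (real n + 2) * (\<Sum>l | l + 2 \<le> n. w l * E l k) + (real n + 1) * E n k)) (legendre_poly k))"
    unfolding bernoulli_poly_convolution w_def[symmetric] B[OF order_refl]
    by (simp add: smult_sum_right smult_add_left[symmetric] sum.distrib[symmetric] sum_distrib_left
        algebra_simps add_divide_distrib)
  also have "\<dots> = (\<Sum>k=0..n. smult ((2 * real k + 1) * (2 ^ (k + 1) *
        (2 / (real n + 2) *
             (\<Sum>l | l + 2 \<le> n. \<Sum>j | j \<le> l \<and> [j = k] (mod 2).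
                bernoulli_num (n - l) * bernoulli_num (l - j) *
                (real ((n + 2) choose l) * real (l choose j) * fact j * fact ((j + k + 2) div 2) *
                   inv_fact ((int j - int k) div 2) / fact (j + k + 2)))
           + (real n + 1) *
             (\<Sum>l | l \<le> n \<and> [l = k] (mod 2).
                real (n choose l) * bernoulli_num (n - l) *
                (fact l * fact ((l + k + 2) div 2) *
                   inv_fact ((int l - int k) div 2) / fact (l + k + 2)))))) (legendre_poly k))"
    unfolding E_def w_def sum_legendre_coeff[symmetric] sum_distrib_left ring_distribs
    by (simp only: mult_ac times_divide_eq_right times_divide_eq_left)
  finally show ?thesis
    by (simp only: const)
qed

end
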